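(* For all positive integers $d$ and $k$ and every integer $r \in [0, d-1]$, there exists a family $\mathcal{P}_{d,k,r}$ of $d$-dimensional 0-1 matrices such that $\operatorname{ex}(n, \mathcal{P}_{d,k,r}, d) = k n^r$ for all $n$ sufficiently large. Moreover, the smallest such $\mathcal{P}_{d,k,r}$ has size $|\mathcal{P}_{d,k,r}| = d-r$.
   Context: A $d$-dimensional 0-1 matrix $A$ contains a $d$-dimensional 0-1 matrix $P$ if $A$ has a submatrix (obtained by restricting each of the $d$ coordinates to a subset of its range) of the same dimensions as $P$ that can be turned into $P$ by changing any number of $1$-entries to $0$-entries; otherwise $A$ avoids $P$. For a family $\mathcal{P}$ of $d$-dimensional 0-1 matrices, $\operatorname{ex}(n,\mathcal{P},d)$ is the maximum possible number of $1$-entries in a $d$-dimensional $n\times\dots\times n$ 0-1 matrix that avoids every element of $\mathcal{P}$ (taken to be $0$ if no such matrix exists). *)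

theory Defs
  imports Complex_Main "HOL-Library.FuncSet"
begin

text \<open>
  A \<open>d\<close>-dimensional matrix is given by its list of \<open>d\<close> side lengths and its entry function on
  multi-indices, which are lists of length \<open>d\<close> with 0-based coordinates.
\<close>

record mat01 =
  dims :: "nat list"
  entry :: "nat list \<Rightarrow> nat"

definition box :: "nat list \<Rightarrow> nat list set" where
  "box ns = {x. length x = length ns \<and> (\<forall>i<length ns. x ! i < ns ! i)}"

text \<open>
  Using the extensional function space (the value is \<open>undefined\<close> outside the index box) makes
  equality of records coincide with equality of matrices, so that the cardinality of a family
  counts each matrix exactly once.
\<close>

definition is_mat01 :: "nat \<Rightarrow> mat01 \<Rightarrow> bool" where
  "is_mat01 d A \<longleftrightarrow>
     length (dims A) = d \<and> (\<forall>m\<in>set (dims A). m > 0) \<and> entry A \<in> box (dims A) \<rightarrow>\<^sub>E {0, 1}"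

text \<open>
  The \<open>i\<close>-th coordinate is restricted to the set \<open>S ! i\<close>, whose elements are renumbered
  in increasing order.
\<close>

definition submat :: "mat01 \<Rightarrow> nat set list \<Rightarrow> mat01" where
  "submat A S =
     \<lparr>dims = map card S,
      entry = (\<lambda>x \<in> box (map card S).
        entry A (map (\<lambda>i. sorted_list_of_set (S ! i) ! (x ! i)) [0..<length S]))\<rparr>"

text \<open>
  For 0-1 matrices of equal dimensions, the pointwise inequality says that \<open>P\<close> arises from the
  submatrix by changing 1-entries to 0-entries.
\<close>

definition contains :: "mat01 \<Rightarrow> mat01 \<Rightarrow> bool" where
  "contains A P \<longleftrightarrow>
     (\<exists>S. length S = length (dims A) \<and> (\<forall>i<length S. S ! i \<subseteq> {..<dims A ! i}) \<and>
          dims (submat A S) = dims P \<and>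
          (\<forall>x\<in>box (dims P). entry P x \<le> entry (submat A S) x))"

definition avoids :: "mat01 \<Rightarrow> mat01 set \<Rightarrow> bool" where
  "avoids A F \<longleftrightarrow> (\<forall>P\<in>F. \<not> contains A P)"

definition num_ones :: "mat01 \<Rightarrow> nat" where
  "num_ones A = card {x \<in> box (dims A). entry A x = 1}"

definition avoiders :: "nat \<Rightarrow> mat01 set \<Rightarrow> nat \<Rightarrow> mat01 set" where
  "avoiders n F d = {A. is_mat01 d A \<and> dims A = replicate d n \<and> avoids A F}"

definition ex_num :: "nat \<Rightarrow> mat01 set \<Rightarrow> nat \<Rightarrow> nat" where
  "ex_num n F d = (if avoiders n F d = {} then 0 else Max (num_ones ` avoiders n F d))"

definition has_ex :: "nat \<Rightarrow> nat \<Rightarrow> nat \<Rightarrow> mat01 set \<Rightarrow> bool" where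
  "has_ex d k r F \<longleftrightarrow>
     (\<forall>P\<in>F. is_mat01 d P) \<and> (\<exists>N. \<forall>n\<ge>N. ex_num n F d = k * n ^ r)"

end

theory Submission
  imports Defs
begin

text \<open>
  Construction: forbidding a full line of \<open>k + 1\<close> ones in direction \<open>0\<close> allows at most \<open>k\<close> ones on
  each such line, and forbidding, for \<open>1 \<le> i \<le> d - r - 1\<close>, the pattern \<open>0 1\<close> in direction \<open>i\<close>
  forces \<open>x\<^sub>i = 0\<close> for every 1-entry \<open>x\<close>. This leaves \<open>k n\<^sup>r\<close> ones, using \<open>d - r\<close> patterns.

  Minimality: let \<open>x\<close> be a 1-entry of a matrix avoiding the family. Each pattern \<open>P\<close> has a direction
  \<open>i\<close> in which its 1-entries cannot all be put at the coordinate \<open>x\<^sub>i\<close>, since otherwise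
  the choices made in the single directions would combine to an embedding of \<open>P\<close> with
  all its 1-entries at \<open>x\<close>. Hence the matrix whose ones are the \<open>y\<close> that agree with \<open>x\<close> in the chosen
  directions avoids the family, and fewer than \<open>d - r\<close> patterns leave it at least \<open>n\<^sup>r\<^sup>+\<^sup>1\<close> ones.
\<close>

section \<open>Submatrix selection and matrices given by their set of ones\<close>

definition pick :: "nat set list \<Rightarrow> nat list \<Rightarrow> nat list" where
  "pick S x = map (\<lambda>i. sorted_list_of_set (S ! i) ! (x ! i)) [0..<length S]"

lemma length_pick [simp]: "length (pick S x) = length S"
  by (simp add: pick_def)

lemma nth_pick [simp]:
  "i < length S \<Longrightarrow> pick S x ! i = sorted_list_of_set (S ! i) ! (x ! i)"
  by (simp add: pick_def)

text \<open>Once the dimensions agree, the restriction inside \<open>submat\<close> is invisible on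
  the box of \<open>P\<close>, so containment is a statement about the index map \<open>pick\<close>
  alone.\<close>

lemma contains_iff:
  "contains A P \<longleftrightarrow>
     (\<exists>S. length S = length (dims A) \<and> (\<forall>i<length S. S ! i \<subseteq> {..<dims A ! i}) \<and>
          map card S = dims P \<and> (\<forall>x\<in>box (dims P). entry P x \<le> entry A (pick S x)))"
  unfolding contains_def submat_def pick_def by (auto cong: conj_cong)

text \<open>Only the part of \<open>X\<close> inside the box matters, so slices can be described
  without length or range conditions.\<close>

definition mat_of :: "nat list \<Rightarrow> nat list set \<Rightarrow> mat01" where
  "mat_of ns X = \<lparr>dims = ns, entry = (\<lambda>x\<in>box ns. if x \<in> X then 1 else 0)\<rparr>"

lemma dims_mat_of [simp]: "dims (mat_of ns X) = ns"
  by (simp add: mat_of_def)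

lemma entry_mat_of [simp]:
  "x \<in> box ns \<Longrightarrow> entry (mat_of ns X) x = (if x \<in> X then 1 else 0)"
  by (simp add: mat_of_def)

lemma is_mat01_mat_of: "is_mat01 (length ns) (mat_of ns X) \<longleftrightarrow> 0 \<notin> set ns"
  by (auto simp: is_mat01_def mat_of_def intro: gr0I)

lemma num_ones_mat_of: "num_ones (mat_of ns X) = card (box ns \<inter> X)"
  unfolding num_ones_def by (rule arg_cong[where f = card]) (auto split: if_splits)

lemma is_mat01_entry_le: "is_mat01 d A \<Longrightarrow> x \<in> box (dims A) \<Longrightarrow> entry A x \<le> 1"
  by (force simp: is_mat01_def PiE_iff)

section \<open>Counting multi-indices; extremal numbers as attained maxima\<close>

text \<open>Transfers finiteness and the product formula from \<open>PiE\<close> to lists in which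
  each coordinate has its own range.\<close>

lemma bij_betw_lists_PiE:
  "bij_betw (\<lambda>x. restrict ((!) x) {..<d}) {x. length x = d \<and> (\<forall>i<d. x ! i \<in> T i)} (PiE {..<d} T)"
proof (rule bij_betw_byWitness[where f' = "\<lambda>g. map g [0..<d]"])
  show "\<forall>x\<in>{x. length x = d \<and> (\<forall>i<d. x ! i \<in> T i)}.
      map (restrict ((!) x) {..<d}) [0..<d] = x"
    by (auto intro: nth_equalityI)
  show "\<forall>g\<in>PiE {..<d} T. restrict ((!) (map g [0..<d])) {..<d} = g"
    by (intro ballI ext) (simp add: restrict_def PiE_def extensional_def)
  show "(\<lambda>x. restrict ((!) x) {..<d}) ` {x. length x = d \<and> (\<forall>i<d. x ! i \<in> T i)} \<subseteq> PiE {..<d} T"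
    by (intro image_subsetI restrict_PiE_iff[THEN iffD2]) simp
  show "(\<lambda>g. map g [0..<d]) ` PiE {..<d} T \<subseteq> {x. length x = d \<and> (\<forall>i<d. x ! i \<in> T i)}"
    by (intro image_subsetI) (simp add: PiE_def Pi_def)
qed

lemma card_lists_nth_in:
  "card {x. length x = d \<and> (\<forall>i<d. x ! i \<in> T i)} = (\<Prod>i<d. card (T i))"
  using bij_betw_same_card[OF bij_betw_lists_PiE[of d T]] by (simp add: card_PiE)

lemma finite_lists_nth_in:
  "(\<And>i. i < d \<Longrightarrow> finite (T i)) \<Longrightarrow> finite {x. length x = d \<and> (\<forall>i<d. x ! i \<in> T i)}"
  using bij_betw_finite[OF bij_betw_lists_PiE[of d T]] finite_PiE[of "{..<d}" T] by simp

lemma box_replicate: "box (replicate d n) = {x. length x = d \<and> (\<forall>i<d. x ! i \<in> {..<n})}"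
  by (auto simp: box_def)

lemma finite_box_replicate [simp]: "finite (box (replicate d n))"
  unfolding box_replicate by (rule finite_lists_nth_in) simp

text \<open>The maximum is over numbers of ones, and these are bounded by the size of the box; the
  set of matrices itself need not be counted.\<close>

lemma finite_num_ones_avoiders: "finite (num_ones ` avoiders n F d)"
proof (rule finite_subset)
  show "num_ones ` avoiders n F d \<subseteq> {..card (box (replicate d n))}"
    by (auto simp: avoiders_def num_ones_def intro!: card_mono)
qed simp

lemma num_ones_le_ex_num: "A \<in> avoiders n F d \<Longrightarrow> num_ones A \<le> ex_num n F d"
  using finite_num_ones_avoiders by (auto simp: ex_num_def)

text \<open>Positivity excludes the default value 0 for an empty set of avoiders.\<close>

lemma ex_num_attained:
  assumes "ex_num n F d > 0"
  obtains A where "A \<in> avoiders n F d" "num_ones A = ex_num n F d"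
proof -
  have ne: "avoiders n F d \<noteq> {}"
    using assms by (auto simp: ex_num_def)
  then have "ex_num n F d \<in> num_ones ` avoiders n F d"
    using Max_in[OF finite_num_ones_avoiders] by (simp add: ex_num_def)
  then show ?thesis
    using that by force
qed

lemma ex_num_eqI:
  assumes "A \<in> avoiders n F d" "num_ones A = m"
    and "\<And>B. B \<in> avoiders n F d \<Longrightarrow> num_ones B \<le> m"
  shows "ex_num n F d = m"
proof -
  have "Max (num_ones ` avoiders n F d) = m"
    by (rule Max_eqI) (use assms finite_num_ones_avoiders in auto)
  then show ?thesis
    using assms(1) by (auto simp: ex_num_def)
qed

subsection \<open>Minimality\<close>

text \<open>The obstruction involves \<open>A\<close> only through one side length and
  \<open>x\<close> only through one coordinate. This is why it carries over to another matrix of the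
  same dimensions.\<close>

lemma obstructing_direction:
  assumes A: "length (dims A) = d" and P: "is_mat01 d P"
    and x: "x \<in> box (dims A)" "entry A x = 1" and nc: "\<not> contains A P"
  shows "\<exists>i<d. \<forall>V\<subseteq>{..<dims A ! i}. card V = dims P ! i \<longrightarrow>
    (\<exists>p\<in>box (dims P). entry P p = 1 \<and> sorted_list_of_set V ! (p ! i) \<noteq> x ! i)"
proof (rule ccontr)
  assume "\<not> ?thesis"
  \<comment> \<open>The guard \<open>i < d\<close> stands inside the existential because
    \<open>choice\<close> needs a set for every natural number.\<close>
  then have "\<forall>i. \<exists>V. i < d \<longrightarrow> V \<subseteq> {..<dims A ! i} \<and> card V = dims P ! i \<and>
      (\<forall>p\<in>box (dims P). entry P p = 1 \<longrightarrow> sorted_list_of_set V ! (p ! i) = x ! i)"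
    by meson
  then obtain V where V: "\<forall>i. i < d \<longrightarrow> V i \<subseteq> {..<dims A ! i} \<and> card (V i) = dims P ! i \<and>
      (\<forall>p\<in>box (dims P). entry P p = 1 \<longrightarrow> sorted_list_of_set (V i) ! (p ! i) = x ! i)"
    by (rule choice[THEN exE])
  have dP: "length (dims P) = d"
    using P by (simp add: is_mat01_def)
  let ?S = "map V [0..<d]"
  have "entry P p \<le> entry A (pick ?S p)" if p: "p \<in> box (dims P)" for p
  proof (cases "entry P p = 1")
    case True
    then have "pick ?S p = x"
      using x A p V by (intro nth_equalityI) (auto simp: box_def)
    then show ?thesis
      using x True by simp
  next
    case False
    then show ?thesis
      using is_mat01_entry_le[OF P p] by simp
  qed
  moreover have "map card ?S = dims P"
    using V dP by (auto intro: nth_equalityI)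
  ultimately have "contains A P"
    unfolding contains_iff using V A by (intro exI[of _ ?S]) auto
  with nc show False ..
qed

text \<open>An embedding into the slice selects some set in direction \<open>i\<close>; the
  obstruction moves a 1-entry of \<open>P\<close> off the coordinate \<open>x ! i\<close>, where the
  slice has no ones. One direction in \<open>I\<close> thus excludes \<open>P\<close>, whatever the
  others are.\<close>

lemma not_contains_slice:
  assumes "i \<in> I" "i < length ns"
    and obs: "\<forall>V\<subseteq>{..<ns ! i}. card V = dims P ! i \<longrightarrow>
      (\<exists>p\<in>box (dims P). entry P p = 1 \<and> sorted_list_of_set V ! (p ! i) \<noteq> x ! i)"
  shows "\<not> contains (mat_of ns {y. \<forall>i\<in>I. y ! i = x ! i}) P"
proof
  assume "contains (mat_of ns {y. \<forall>i\<in>I. y ! i = x ! i}) P"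
  then obtain S where S: "length S = length ns" "\<forall>i<length S. S ! i \<subseteq> {..<ns ! i}"
      "map card S = dims P"
      "\<forall>p\<in>box (dims P). entry P p \<le> entry (mat_of ns {y. \<forall>i\<in>I. y ! i = x ! i}) (pick S p)"
    unfolding contains_iff by auto
  have "card (S ! i) = dims P ! i"
    using S assms by (metis nth_map)
  then obtain p where p: "p \<in> box (dims P)" "entry P p = 1"
      "sorted_list_of_set (S ! i) ! (p ! i) \<noteq> x ! i"
    using obs S assms by metis
  \<comment> \<open>Outside the box the entry is \<open>undefined\<close>, so being a one there
    would say nothing about the slice.\<close>
  have "pick S p \<in> box ns"
  proof -
    have "sorted_list_of_set (S ! j) ! (p ! j) < ns ! j" if j: "j < length ns" for j
    proof -
      have "p ! j < card (S ! j)"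
        using p(1) S(1) j by (auto simp: box_def simp flip: S(3))
      moreover have "finite (S ! j)"
        using S j by (metis finite_lessThan finite_subset)
      ultimately have "sorted_list_of_set (S ! j) ! (p ! j) \<in> S ! j"
        by (metis length_sorted_list_of_set nth_mem set_sorted_list_of_set)
      then show ?thesis
        using S j by auto
    qed
    then show ?thesis
      using S by (auto simp: box_def)
  qed
  moreover have "entry (mat_of ns {y. \<forall>i\<in>I. y ! i = x ! i}) (pick S p) \<ge> 1"
    using bspec[OF S(4) p(1)] unfolding p(2) .
  ultimately have "\<forall>i\<in>I. pick S p ! i = x ! i"
    by (simp split: if_splits)
  then show False
    using p(3) assms S(1) by force
qed

lemma card_slice:
  assumes "x \<in> box (replicate d n)" "I \<subseteq> {..<d}"
  shows "card (box (replicate d n) \<inter> {y. \<forall>i\<in>I. y ! i = x ! i}) = n ^ (d - card I)"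
proof -
  have "box (replicate d n) \<inter> {y. \<forall>i\<in>I. y ! i = x ! i} =
      {y. length y = d \<and> (\<forall>i<d. y ! i \<in> (if i \<in> I then {x ! i} else {..<n}))}" (is "?L = ?R")
  proof (intro equalityI subsetI)
    fix y assume "y \<in> ?L"
    then show "y \<in> ?R"
      by (simp add: box_replicate)
  next
    fix y assume y: "y \<in> ?R"
    have yi: "y ! i \<in> (if i \<in> I then {x ! i} else {..<n})" if "i < d" for i
      using y that by simp
    have "y ! i = x ! i" if "i \<in> I" for i
      using yi[of i] that assms(2) by auto
    moreover have "y ! i < n" if "i < d" for i
      using yi[OF that] that assms(1) by (cases "i \<in> I") (simp_all add: box_replicate)
    ultimately show "y \<in> ?L"
      using y by (simp add: box_replicate)
  qed
  then have "card (box (replicate d n) \<inter> {y. \<forall>i\<in>I. y ! i = x ! i}) =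
      (\<Prod>i<d. card (if i \<in> I then {x ! i} else {..<n}))"
    by (simp only: card_lists_nth_in)
  also have "\<dots> = (\<Prod>i\<in>{..<d} - I. n)"
    by (rule prod.mono_neutral_cong_right) auto
  finally show ?thesis
    using assms by (simp add: card_Diff_subset finite_subset)
qed

lemma has_ex_card_ge:
  assumes "k > 0" "has_ex d k r F" "finite F"
  shows "d - r \<le> card F"
proof (rule ccontr)
  assume less: "\<not> d - r \<le> card F"
  obtain N where mats: "\<forall>P\<in>F. is_mat01 d P" and N: "\<forall>n\<ge>N. ex_num n F d = k * n ^ r"
    using assms(2) by (auto simp: has_ex_def)
  \<comment> \<open>\<open>n >= N\<close> makes the formula for the extremal number valid, and
    \<open>n > k\<close> makes \<open>k * n ^ r\<close> smaller than
    \<open>n ^ Suc r\<close>.\<close>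
  define n where "n = max N (Suc k)"
  have ex: "ex_num n F d = k * n ^ r"
    using N by (simp add: n_def)
  moreover have "k * n ^ r > 0"
    using assms(1) by (simp add: n_def less_max_iff_disj)
  ultimately obtain A where A: "A \<in> avoiders n F d" "num_ones A > 0"
    using ex_num_attained by metis
  then have dA: "dims A = replicate d n" and nc: "\<forall>P\<in>F. \<not> contains A P"
    by (auto simp: avoiders_def avoids_def)
  obtain x where x: "x \<in> box (dims A)" "entry A x = 1"
    using A(2) by (auto simp: num_ones_def card_gt_0_iff)
  have "\<forall>P\<in>F. \<exists>i<d. \<forall>V\<subseteq>{..<replicate d n ! i}. card V = dims P ! i \<longrightarrow>
      (\<exists>p\<in>box (dims P). entry P p = 1 \<and> sorted_list_of_set V ! (p ! i) \<noteq> x ! i)"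
    using obstructing_direction[of A d _ x] dA mats nc x by simp
  then obtain dir where dir: "\<forall>P\<in>F. dir P < d \<and>
      (\<forall>V\<subseteq>{..<replicate d n ! dir P}. card V = dims P ! dir P \<longrightarrow>
        (\<exists>p\<in>box (dims P). entry P p = 1 \<and> sorted_list_of_set V ! (p ! dir P) \<noteq> x ! dir P))"
    by metis
  define B where "B = mat_of (replicate d n) {y. \<forall>i\<in>dir ` F. y ! i = x ! i}"
  have "\<forall>P\<in>F. \<not> contains B P"
  proof
    fix P assume P: "P \<in> F"
    show "\<not> contains B P"
      unfolding B_def by (rule not_contains_slice[where i = "dir P"]) (use P dir in auto)
  qed
  moreover have "is_mat01 d B"
    using is_mat01_mat_of[of "replicate d n"] by (auto simp: B_def n_def)
  ultimately have "B \<in> avoiders n F d"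
    by (simp add: avoiders_def avoids_def B_def)
  then have "num_ones B \<le> k * n ^ r"
    using num_ones_le_ex_num ex by metis
  also have "\<dots> < n ^ Suc r"
    by (simp add: n_def less_max_iff_disj)
  \<comment> \<open>Several patterns may share a direction, which only enlarges the slice: at least
    \<open>r + 1\<close> directions stay free.\<close>
  also have "\<dots> \<le> n ^ (d - card (dir ` F))"
    using card_image_le[OF assms(3), of dir] less
    by (intro power_increasing) (auto simp: n_def)
  also have "\<dots> = num_ones B"
    unfolding B_def num_ones_mat_of by (rule card_slice[symmetric]) (use x dA dir in auto)
  finally show False
    by simp
qed

subsection \<open>Construction\<close>

text \<open>Both kinds of forbidden pattern extend in one direction only. Selecting
  \<open>{y ! j}\<close> in every other direction \<open>j\<close> cuts out a piece of the line
  through \<open>y\<close> in direction \<open>i\<close>.\<close>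

lemma contains_lineI:
  assumes dA: "dims A = replicate d n" and y: "y \<in> box (replicate d n)"
    and V: "V \<subseteq> {..<n}" and i: "i < d" and dP: "dims P = (replicate d 1)[i := card V]"
    and le: "\<And>x. x \<in> box (dims P) \<Longrightarrow> entry P x \<le> entry A (y[i := sorted_list_of_set V ! (x ! i)])"
  shows "contains A P"
  unfolding contains_iff
proof (intro exI conjI ballI)
  let ?S = "(map (\<lambda>j. {y ! j}) [0..<d])[i := V]"
  show "length ?S = length (dims A)"
    by (simp add: dA)
  show "\<forall>j<length ?S. ?S ! j \<subseteq> {..<dims A ! j}"
  proof (intro allI impI)
    fix j assume "j < length ?S"
    then show "?S ! j \<subseteq> {..<dims A ! j}"
      using y V dA by (cases "j = i") (auto simp: box_replicate)
  qed
  show "map card ?S = dims P"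
    unfolding dP by (simp add: map_update comp_def map_replicate_const)
  fix x assume x: "x \<in> box (dims P)"
  have "pick ?S x = y[i := sorted_list_of_set V ! (x ! i)]"
  proof (rule nth_equalityI)
    show "length (pick ?S x) = length (y[i := sorted_list_of_set V ! (x ! i)])"
      using y by (simp add: box_replicate)
    fix j assume j: "j < length (pick ?S x)"
    have "x ! j = 0" if "j \<noteq> i"
      using x that j by (auto simp: box_def dP nth_list_update)
    then show "pick ?S x ! j = y[i := sorted_list_of_set V ! (x ! i)] ! j"
      using j y by (cases "j = i") (auto simp: box_replicate)
  qed
  then show "entry P x \<le> entry A (pick ?S x)"
    using le[OF x] by simp
qed

section \<open>The forbidden patterns and their number\<close>

definition line_pat :: "nat \<Rightarrow> nat \<Rightarrow> mat01" where
  "line_pat d k = mat_of ((replicate d 1)[0 := Suc k]) UNIV"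

text \<open>The first of the two entries is 0 and so matches anything: a 1-entry completes this
  pattern as soon as its coordinate \<open>i\<close> is positive.\<close>

definition step_pat :: "nat \<Rightarrow> nat \<Rightarrow> mat01" where
  "step_pat d i = mat_of ((replicate d 1)[i := 2]) {x. x ! i = 1}"

text \<open>Direction 0 is reserved for the line pattern; \<open>s\<close> is later taken to be
  \<open>d - Suc r\<close>.\<close>

definition pats :: "nat \<Rightarrow> nat \<Rightarrow> nat \<Rightarrow> mat01 set" where
  "pats d k s = insert (line_pat d k) (step_pat d ` {1..s})"

lemma is_mat01_pats: "P \<in> pats d k s \<Longrightarrow> is_mat01 d P"
  using is_mat01_mat_of[of "(replicate d 1)[0 := Suc k]"]
    is_mat01_mat_of[of "(replicate d 1)[i := 2]" for i]
  by (auto simp: pats_def line_pat_def step_pat_def dest!: subsetD[OF set_update_subset_insert])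

text \<open>The dimensions tell the patterns apart: \<open>step_pat d i\<close> has side 2 exactly
  in direction \<open>i\<close>, while the line pattern has side \<open>Suc k > 1\<close> in
  direction 0, where all step patterns used have side 1.\<close>

lemma card_pats:
  assumes "k > 0" "s < d"
  shows "card (pats d k s) = Suc s"
proof -
  have dims_step: "dims (step_pat d i) ! j = (if j = i then 2 else 1)" if "j < d" for i j
    using that by (auto simp: step_pat_def nth_list_update)
  have "inj_on (step_pat d) {1..s}"
  proof (rule inj_onI)
    fix i j assume "i \<in> {1..s}" "j \<in> {1..s}" "step_pat d i = step_pat d j"
    then show "i = j"
      using dims_step[of i i] dims_step[of i j] assms by (auto split: if_splits)
  qed
  moreover have "line_pat d k \<notin> step_pat d ` {1..s}"
  proof
    assume "line_pat d k \<in> step_pat d ` {1..s}"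
    then obtain i where "i \<in> {1..s}" "line_pat d k = step_pat d i"
      by auto
    moreover have "dims (line_pat d k) ! 0 = Suc k"
      using assms by (simp add: line_pat_def)
    ultimately show False
      using dims_step[of 0 i] assms by simp
  qed
  ultimately show ?thesis
    by (simp add: pats_def card_image)
qed

section \<open>Upper bound for matrices avoiding the patterns\<close>

lemma avoid_step_pat:
  assumes "dims A = replicate d n" "i < d" "\<not> contains A (step_pat d i)"
    and y: "y \<in> box (replicate d n)" "entry A y = 1"
  shows "y ! i = 0"
proof (rule ccontr)
  assume pos: "y ! i \<noteq> 0"
  have yi: "y ! i < n"
    using y assms(2) by (auto simp: box_replicate)
  have "contains A (step_pat d i)"
  proof (rule contains_lineI[of A d n y "{0, y ! i}" i])
    show "dims (step_pat d i) = (replicate d 1)[i := card {0, y ! i}]"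
      using pos by (simp add: step_pat_def numeral_2_eq_2)
    fix x assume "x \<in> box (dims (step_pat d i))"
    \<comment> \<open>The 1-entry of the pattern has index 1 and is therefore sent to
      \<open>y\<close> itself.\<close>
    moreover have "sorted_list_of_set {0, y ! i} = [0, y ! i]"
      using pos by simp
    ultimately show "entry (step_pat d i) x \<le> entry A (y[i := sorted_list_of_set {0, y ! i} ! (x ! i)])"
      using y by (auto simp: step_pat_def)
  qed (use assms yi in auto)
  with assms show False
    by blast
qed

text \<open>A line in direction 0 is named by \<open>z\<close>, the common value of its points after
  coordinate 0 is erased. Points of \<open>L\<close> are recovered from coordinate 0, so
  \<open>k + 1\<close> of them supply \<open>k + 1\<close> positions for the line pattern.\<close>

lemma avoid_line_pat:
  assumes dA: "dims A = replicate d n" and d: "d > 0" and nc: "\<not> contains A (line_pat d k)"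
    and L: "L \<subseteq> {x \<in> box (replicate d n). entry A x = 1}"
    and line: "\<And>x. x \<in> L \<Longrightarrow> x[0 := 0] = z"
  shows "card L \<le> k"
proof (rule ccontr)
  assume less: "\<not> card L \<le> k"
  have upd: "x = z[0 := x ! 0]" if "x \<in> L" for x
    using line[OF that] by (metis list_update_id list_update_overwrite)
  have "inj_on (\<lambda>x. x ! 0) L"
    by (rule inj_onI) (metis upd)
  then have "card ((\<lambda>x. x ! 0) ` L) \<ge> Suc k"
    using less by (simp add: card_image)
  then obtain V where V: "V \<subseteq> (\<lambda>x. x ! 0) ` L" "card V = Suc k"
    by (metis obtain_subset_with_card_n)
  have finV: "finite V"
    using V(2) by (metis card.infinite nat.distinct(1))
  have zL: "z[0 := v] \<in> L" if "v \<in> V" for v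
  proof -
    obtain x where "x \<in> L" "v = x ! 0"
      using V(1) \<open>v \<in> V\<close> by blast
    then show ?thesis
      using upd[of x] by simp
  qed
  \<comment> \<open>Any point of \<open>L\<close> can be the base point for
    \<open>contains_lineI\<close>, since its coordinate 0 gets overwritten.\<close>
  obtain v where v: "v \<in> V"
    using V(2) by fastforce
  have "contains A (line_pat d k)"
  proof (rule contains_lineI[of A d n "z[0 := v]" V 0])
    show "V \<subseteq> {..<n}"
      using V(1) L d by (auto simp: box_replicate)
    show "dims (line_pat d k) = (replicate d 1)[0 := card V]"
      by (simp add: line_pat_def V)
    fix x assume x: "x \<in> box (dims (line_pat d k))"
    then have "x ! 0 < card V"
      using d V(2) by (auto simp: box_def line_pat_def)
    then have "sorted_list_of_set V ! (x ! 0) \<in> V"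
      using finV by (metis length_sorted_list_of_set nth_mem set_sorted_list_of_set)
    then have "entry A (z[0 := v, 0 := sorted_list_of_set V ! (x ! 0)]) = 1"
      using zL L by auto
    then show "entry (line_pat d k) x \<le> entry A (z[0 := v, 0 := sorted_list_of_set V ! (x ! 0)])"
      using x by (simp add: line_pat_def)
  qed (use dA d zL[OF v] L in auto)
  with nc show False ..
qed

lemma card_le_fibres:
  assumes "finite X" "\<And>z. z \<in> f ` X \<Longrightarrow> card {x \<in> X. f x = z} \<le> k"
  shows "card X \<le> k * card (f ` X)"
proof -
  have "card X = card (\<Union>z\<in>f ` X. {x \<in> X. f x = z})"
    by (rule arg_cong[where f = card]) auto
  also have "\<dots> \<le> (\<Sum>z\<in>f ` X. card {x \<in> X. f x = z})"
    using assms(1) by (intro card_UN_le) simp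
  also have "\<dots> \<le> card (f ` X) * k"
    using sum_bounded_above[of "f ` X" "\<lambda>z. card {x \<in> X. f x = z}" k] assms(2) by simp
  finally show ?thesis
    by (simp add: mult.commute)
qed

text \<open>Serves twice: with the given \<open>k\<close> it counts the ones of the extremal matrix,
  and with 1 in its place the lines in direction 0 that can carry ones.\<close>

lemma card_slab:
  assumes "s < d"
  shows "card {x. length x = d \<and> (\<forall>i<d. x ! i \<in> (if i = 0 then {..<k} else if i \<le> s then {0} else {..<n}))}
    = k * n ^ (d - Suc s)"
proof -
  have "(\<Prod>i<d. card (if i = 0 then {..<k} else if i \<le> s then {0} else {..<n}))
      = k * (\<Prod>i\<in>{..<d} - {0}. if i \<le> s then 1 else n)"
    using assms by (subst prod.remove[of _ 0]) (auto intro!: prod.cong split: if_splits)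
  also have "(\<Prod>i\<in>{..<d} - {0}. if i \<le> s then 1 else n) = (\<Prod>i\<in>{Suc s..<d}. n)"
    by (rule prod.mono_neutral_cong_right) auto
  finally show ?thesis
    unfolding card_lists_nth_in by simp
qed

lemma num_ones_avoid_pats_le:
  assumes "s < d" "A \<in> avoiders n (pats d k s) d"
  shows "num_ones A \<le> k * n ^ (d - Suc s)"
proof -
  let ?X = "{x \<in> box (dims A). entry A x = 1}"
  have dA: "dims A = replicate d n" and line: "\<not> contains A (line_pat d k)"
    using assms(2) by (auto simp: avoiders_def avoids_def pats_def)
  have step: "\<not> contains A (step_pat d i)" if "1 \<le> i" "i \<le> s" for i
    using assms(2) that by (auto simp: avoiders_def avoids_def pats_def)
  \<comment> \<open>The range \<open>{..<1}\<close> is \<open>{0}\<close> in the form that matches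
    \<open>card_slab\<close>.\<close>
  let ?T = "{x. length x = d \<and>
    (\<forall>i<d. x ! i \<in> (if i = 0 then {..<1} else if i \<le> s then {0} else {..<n}))}"
  have "card ?X \<le> k * card ((\<lambda>x. x[0 := 0]) ` ?X)"
  proof (rule card_le_fibres)
    fix z
    show "card {x \<in> ?X. x[0 := 0] = z} \<le> k"
      by (rule avoid_line_pat[OF dA _ line, where z = z]) (use assms(1) dA in auto)
  qed (simp add: dA)
  moreover have "(\<lambda>x. x[0 := 0]) ` ?X \<subseteq> ?T"
  proof (rule image_subsetI)
    fix x assume "x \<in> ?X"
    then have x: "x \<in> box (replicate d n)" "entry A x = 1"
      by (simp_all add: dA)
    have "x[0 := 0] ! i \<in> (if i = 0 then {..<1} else if i \<le> s then {0} else {..<n})" if "i < d" for i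
      using avoid_step_pat[OF dA that step x] x(1) that
      by (cases "i = 0") (auto simp: box_replicate)
    then show "x[0 := 0] \<in> ?T"
      using x(1) by (simp add: box_replicate)
  qed
  moreover have "finite ?T"
    by (rule finite_lists_nth_in) simp
  ultimately have "card ?X \<le> k * card ?T"
    by (meson card_mono mult_le_mono2 order_trans)
  then show ?thesis
    unfolding num_ones_def card_slab[OF assms(1)] by simp
qed

section \<open>The extremal matrix\<close>

text \<open>The line pattern would need \<open>k + 1\<close> values below \<open>k\<close> in
  direction 0. A step pattern would need its 1-entry at the second smallest selected index, which is
  positive.\<close>

lemma not_contains_pats:
  assumes "s < d" "P \<in> pats d k s"
  shows "\<not> contains (mat_of (replicate d n) {x. x ! 0 < k \<and> (\<forall>i\<in>{1..s}. x ! i = 0)}) P"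
    (is "\<not> contains ?A P")
proof
  assume "contains ?A P"
  then obtain S where S: "length S = d" "\<forall>i<d. S ! i \<subseteq> {..<n}" "map card S = dims P"
      "\<forall>p\<in>box (dims P). entry P p \<le> entry ?A (pick S p)"
    unfolding contains_iff by auto
  have card_S: "card (S ! i) = dims P ! i" if "i < d" for i
    using S that by (metis nth_map)
  have nth_S: "sorted_list_of_set (S ! i) ! (p ! i) < n" if "p \<in> box (dims P)" "i < d" for p i
  proof -
    have "p ! i < card (S ! i)"
      using that S(1) by (auto simp: box_def simp flip: S(3))
    then have "sorted_list_of_set (S ! i) ! (p ! i) \<in> S ! i"
      by (metis card.infinite length_sorted_list_of_set not_less_zero nth_mem set_sorted_list_of_set)
    then show ?thesis
      using S(2) that by auto
  qed
  have ones: "pick S p ! 0 < k \<and> (\<forall>i\<in>{1..s}. pick S p ! i = 0)"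
    if "p \<in> box (dims P)" "entry P p = 1" for p
  proof -
    have "pick S p \<in> box (replicate d n)"
      using nth_S[OF that(1)] S(1) by (auto simp: box_replicate)
    moreover have "entry ?A (pick S p) \<ge> 1"
      using bspec[OF S(4) that(1)] unfolding that(2) .
    ultimately show ?thesis
      by (simp split: if_splits)
  qed
  consider "P = line_pat d k" | i where "i \<in> {1..s}" "P = step_pat d i"
    using assms(2) by (auto simp: pats_def)
  then show False
  proof cases
    case 1
    \<comment> \<open>The line pattern is full of ones, so every selected value occurs as coordinate
      0 of the image of a 1-entry.\<close>
    have "S ! 0 \<subseteq> {..<k}"
    proof
      fix v assume v: "v \<in> S ! 0"
      have "finite (S ! 0)"
        using S(2) assms(1) by (metis finite_lessThan finite_subset gr_zeroI not_less_zero)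
      then obtain j where j: "j < card (S ! 0)" "v = sorted_list_of_set (S ! 0) ! j"
        using v by (metis in_set_conv_nth length_sorted_list_of_set set_sorted_list_of_set)
      let ?p = "(replicate d 0)[0 := j]"
      have "?p \<in> box (dims P)"
        using j card_S[of 0] assms(1) by (auto simp: 1 line_pat_def box_def nth_list_update)
      then have "pick S ?p ! 0 < k"
        using ones by (auto simp: 1 line_pat_def)
      then show "v \<in> {..<k}"
        using j S(1) assms(1) by simp
    qed
    then have "card (S ! 0) \<le> k"
      using card_mono[of "{..<k}"] by auto
    then show False
      using card_S[of 0] assms(1) by (simp add: 1 line_pat_def)
  next
    case 2
    \<comment> \<open>This is the only 1-entry of the step pattern.\<close>
    let ?p = "(replicate d 0)[i := 1]"
    have id: "i < d"
      using 2 assms(1) by auto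
    have p: "?p \<in> box (dims P)"
      using id by (auto simp: 2 step_pat_def box_def nth_list_update)
    have "entry P ?p = 1"
      using p id by (simp add: 2 step_pat_def)
    then have "pick S ?p ! i = 0"
      using ones[OF p] 2 by blast
    then have "sorted_list_of_set (S ! i) ! 1 = 0"
      using id S(1) by simp
    moreover have "card (S ! i) = 2"
      using card_S[OF id] id by (simp add: 2 step_pat_def)
    moreover have "sorted_list_of_set (S ! i) ! 0 < sorted_list_of_set (S ! i) ! 1"
      using \<open>card (S ! i) = 2\<close> by (intro sorted_wrt_nth_less[of "(<)"]) auto
    ultimately show False
      by simp
  qed
qed

lemma has_ex_pats:
  assumes "s < d"
  shows "has_ex d k (d - Suc s) (pats d k s)"
  unfolding has_ex_def
proof (intro conjI exI allI impI)
  show "\<forall>P\<in>pats d k s. is_mat01 d P"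
    using is_mat01_pats by blast
  \<comment> \<open>This threshold keeps the sides positive and fits \<open>{..<k}\<close> into
    \<open>{..<n}\<close>.\<close>
  fix n assume n: "n \<ge> Suc k"
  let ?X = "{x. x ! 0 < k \<and> (\<forall>i\<in>{1..s}. x ! i = 0)}"
  show "ex_num n (pats d k s) d = k * n ^ (d - Suc s)"
  proof (rule ex_num_eqI)
    have "is_mat01 d (mat_of (replicate d n) ?X)"
      using is_mat01_mat_of[of "replicate d n" ?X] n by auto
    then show "mat_of (replicate d n) ?X \<in> avoiders n (pats d k s) d"
      using not_contains_pats[OF assms] by (simp add: avoiders_def avoids_def)
    have "box (replicate d n) \<inter> ?X = {x. length x = d \<and>
        (\<forall>i<d. x ! i \<in> (if i = 0 then {..<k} else if i \<le> s then {0} else {..<n}))}" (is "?L = ?R")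
    proof (intro equalityI subsetI)
      fix x assume "x \<in> ?L"
      then show "x \<in> ?R"
        by (simp add: box_replicate)
    next
      fix x assume x: "x \<in> ?R"
      have xi: "x ! i \<in> (if i = 0 then {..<k} else if i \<le> s then {0} else {..<n})" if "i < d" for i
        using x that by simp
      have "x ! i < n" if "i < d" for i
        using xi[OF that] n by (simp split: if_splits)
      moreover have "x ! 0 < k"
        using xi[of 0] assms by simp
      moreover have "x ! i = 0" if "i \<in> {1..s}" for i
        using xi[of i] assms that by simp
      ultimately show "x \<in> ?L"
        using x by (simp add: box_replicate)
    qed
    then show "num_ones (mat_of (replicate d n) ?X) = k * n ^ (d - Suc s)"
      using card_slab[OF assms] by (simp add: num_ones_mat_of)
  qed (rule num_ones_avoid_pats_le[OF assms])
qed

theorem theorem3p26: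
  fixes d k r :: nat
  assumes "d > 0" and "k > 0" and "r \<in> {0..d - 1}"
  shows "(\<exists>F. has_ex d k r F) \<and>
         (\<exists>F. has_ex d k r F \<and> finite F \<and> card F = d - r) \<and>
         (\<forall>F. has_ex d k r F \<and> finite F \<longrightarrow> d - r \<le> card F)"
proof -
  \<comment> \<open>As \<open>r < d\<close>, the subtraction is not truncated, and the line pattern
    with \<open>s\<close> step patterns makes \<open>d - r\<close>.\<close>
  define s where "s = d - Suc r"
  have s: "s < d" "d - Suc s = r" "Suc s = d - r"
    using assms by (auto simp: s_def)
  have "has_ex d k r (pats d k s)" "finite (pats d k s)" "card (pats d k s) = d - r"
    using has_ex_pats[OF s(1), of k] card_pats[OF assms(2) s(1)] s by (auto simp: pats_def)
  then show ?thesis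
    using has_ex_card_ge[OF assms(2)] by blast
qed

end
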